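(* Let $f:\mathcal E\to[0,\infty]$ be concave and upper semicontinuous with $S_0:=\operatorname{cl}(\operatorname{dom} f)$ bounded, i.e. $D_0:=D(S_0)<\infty$; let $S_1,\dots,S_m\subseteq\mathcal E$ be closed and convex and $\mathcal S:=\bigcap_{j=1}^m S_j$; let $\varphi_{\mathcal S}$ be a convex identifier of $\mathcal S$ and let $e_0\in\operatorname{int}S_0$, with $R_0:=R_{e_0}(S_0)>0$. Suppose there exist $x^*\in\mathcal S$ with $f(x^* )=p^*>0$ and $x_{SL}\in\operatorname{int}\mathcal S\cap\operatorname{dom}f$ such that $\eta:=(1-\gamma_{S_0,e_0}(x^* ))(1-\varphi_{\mathcal S}(x_{SL}))>0$. Let $\Psi,\Phi$ be the primal and multiradial dual functions, with $p^*=\max_{x\in\mathcal E}\Psi(x)$ and $d^*=\min_{y\in\mathcal E}\Phi(y)$. If $p^*=1$ or $d^*=1$, then $$\operatorname{argmax}\Psi\times\{p^*\}=\operatorname{argmin}\Phi\times\{d^*\}.$$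
   Context: $\mathcal E$ is a finite-dimensional Euclidean space with inner product $\langle\cdot,\cdot\rangle$ and induced norm $\|\cdot\|$. For $f:\mathcal E\to[0,\infty]$: $\operatorname{dom}f=\{x: 0<f(x)<\infty\}$, $\operatorname{hypo}f=\{(x,u)\in\mathcal E\times(0,\infty): f(x)\ge u\}$, and $f$ is concave if $\operatorname{hypo}f$ is convex. For a set $S$ and $e\in S$: $\gamma_{S,e}(x)=\inf\{v>0: e+\frac{x-e}{v}\in S\}$ (gauge), $R_e(S)=\inf\{\|x-e\|: x\notin S\}$, $D(S)=\sup\{\|x-y\|: x,y\in S\}$. For $e\in\mathcal E$ the radial transform is $f^{\Gamma,e}(y)=\sup\{v>0: v f(e+\frac{y-e}{v})\le1\}$, with $\sup\emptyset=0$. A convex identifier of $\mathcal S$ is a lower semicontinuous convex function $\varphi_{\mathcal S}:\mathcal E\to\mathbb R$ with $\operatorname{int}\mathcal S=\{x:\varphi_{\mathcal S}(x)<1\}$. The primal function is $\Psi(x)=\min\{f(x),\hat\iota_{\mathcal S}(x)\}$, where $\hat\iota_{\mathcal S}(x)=+\infty$ if $x\in\mathcal S$ and $0$ otherwise (so $p^*=\max_{x\in\mathcal S}f(x)$). The multiradial dual function is $\Phi(y)=\max\{f^{\Gamma,e_0}(y),\varphi_{\mathcal S}(y)\}$. *)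

theory Defs
  imports "HOL-Analysis.Analysis"
begin

definition pos_dom :: "('a \<Rightarrow> ennreal) \<Rightarrow> 'a set" where
  "pos_dom f = {x. 0 < f x \<and> f x < \<infinity>}"

definition hypograph :: "('a \<Rightarrow> ennreal) \<Rightarrow> ('a \<times> real) set" where
  "hypograph f = {(x, u). 0 < u \<and> ennreal u \<le> f x}"

definition concave_fun :: "('a::real_vector \<Rightarrow> ennreal) \<Rightarrow> bool" where
  "concave_fun f \<longleftrightarrow> convex (hypograph f)"

definition usc :: "('a::topological_space \<Rightarrow> 'b::linorder) \<Rightarrow> bool" where
  "usc f \<longleftrightarrow> (\<forall>x. \<forall>c. f x < c \<longrightarrow> eventually (\<lambda>y. f y < c) (nhds x))"

definition lsc :: "('a::topological_space \<Rightarrow> 'b::linorder) \<Rightarrow> bool" where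
  "lsc f \<longleftrightarrow> (\<forall>x. \<forall>c. c < f x \<longrightarrow> eventually (\<lambda>y. c < f y) (nhds x))"

text \<open>
  The gauge, the radius and the diameter of a set are extended-real valued, so that an infimum over
  the empty set and a supremum over an unbounded set are \<open>\<infinity>\<close>, as in the usual convention
  (the real-valued \<open>Inf\<close> and \<open>diameter\<close> take arbitrary values there).
\<close>

definition gauge_at :: "'a::real_vector set \<Rightarrow> 'a \<Rightarrow> 'a \<Rightarrow> ereal" where
  "gauge_at S e x = Inf {ereal v | v. 0 < v \<and> e + (x - e) /\<^sub>R v \<in> S}"

definition radius_at :: "'a::real_normed_vector \<Rightarrow> 'a set \<Rightarrow> ereal" where
  "radius_at e S = Inf {ereal (norm (x - e)) | x. x \<notin> S}"

definition diam :: "'a::real_normed_vector set \<Rightarrow> ereal" where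
  "diam S = Sup {ereal (norm (x - y)) | x y. x \<in> S \<and> y \<in> S}"

text \<open>In \<open>ennreal\<close> the supremum of the empty set is \<open>0\<close>.\<close>

definition radial_transform :: "'a::real_vector \<Rightarrow> ('a \<Rightarrow> ennreal) \<Rightarrow> 'a \<Rightarrow> ennreal" where
  "radial_transform e f y =
     Sup {ennreal v | v. 0 < v \<and> ennreal v * f (e + (y - e) /\<^sub>R v) \<le> 1}"

definition convex_identifier :: "('a::real_normed_vector \<Rightarrow> real) \<Rightarrow> 'a set \<Rightarrow> bool" where
  "convex_identifier \<phi> S \<longleftrightarrow> lsc \<phi> \<and> convex_on UNIV \<phi> \<and> interior S = {x. \<phi> x < 1}"

definition upper_indicator :: "'a set \<Rightarrow> 'a \<Rightarrow> ereal" where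
  "upper_indicator S x = (if x \<in> S then \<infinity> else 0)"

text \<open>
  Both objectives are taken in \<open>ereal\<close>, since a convex identifier may be negative.
\<close>

definition primal_fun :: "('a \<Rightarrow> ennreal) \<Rightarrow> 'a set \<Rightarrow> 'a \<Rightarrow> ereal" where
  "primal_fun f S x = min (enn2ereal (f x)) (upper_indicator S x)"

definition dual_fun :: "'a::real_vector \<Rightarrow> ('a \<Rightarrow> ennreal) \<Rightarrow> ('a \<Rightarrow> real) \<Rightarrow> 'a \<Rightarrow> ereal" where
  "dual_fun e f \<phi> y = max (enn2ereal (radial_transform e f y)) (ereal (\<phi> y))"

definition argmax :: "('a \<Rightarrow> 'b::ord) \<Rightarrow> 'a set" where
  "argmax g = {x. is_arg_max g (\<lambda>_. True) x}"

definition argmin :: "('a \<Rightarrow> 'b::ord) \<Rightarrow> 'a set" where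
  "argmin g = {x. is_arg_min g (\<lambda>_. True) x}"

end

theory Submission
  imports Defs
begin

text \<open>
  Write \<open>g\<close> for the radial transform of \<open>f\<close> at \<open>e\<close>. Concavity together with \<open>f e > 0\<close> makes
  \<open>v \<mapsto> v * f (e + (y - e) / v)\<close> strictly increasing where it is positive, and upper semicontinuity
  makes it right continuous, so \<open>g y \<le> 1 \<longleftrightarrow> f y \<ge> 1\<close>. Likewise
  \<open>\<phi> x \<le> 1\<close> describes \<open>SS\<close>, by the Slater point. Hence \<open>\<Phi> \<le> 1\<close> holds exactly where
  \<open>\<Psi> \<ge> 1\<close>, and \<open>\<Phi> < 1\<close> forces \<open>\<Psi> > 1\<close>; this settles the case \<open>pstar = 1\<close>.

  If \<open>dstar = 1\<close>, then \<open>pstar = 1\<close>. When \<open>pstar > 1\<close>, the condition \<open>\<eta> > 0\<close> keeps \<open>xstar\<close> off the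
  boundary of the domain of \<open>f\<close>, and moving it slightly towards the Slater point gives a point with
  \<open>\<Phi> < 1\<close>. When \<open>pstar < 1\<close>, points with \<open>\<Phi> < 1 + \<epsilon>\<close> can be moved to feasible points where
  \<open>f\<close> is at least \<open>1 - O(\<epsilon>)\<close>.
\<close>

section \<open>Extended-valued concave functions and convex identifiers\<close>

lemma concave_funD:
  assumes "concave_fun f" "0 < u" "ennreal u \<le> f x" "0 < w" "ennreal w \<le> f y" "0 \<le> t" "t \<le> 1"
  shows "ennreal ((1 - t) * u + t * w) \<le> f ((1 - t) *\<^sub>R x + t *\<^sub>R y)"
proof -
  have "(1 - t) *\<^sub>R (x, u) + t *\<^sub>R (y, w) \<in> hypograph f"
    using assms unfolding concave_fun_def
    by (intro convexD) (auto simp: hypograph_def)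
  then show ?thesis
    by (simp add: hypograph_def)
qed

lemma tendsto_segment:
  fixes x y :: "'a::real_normed_vector"
  shows "((\<lambda>t. (1 - t) *\<^sub>R x + t *\<^sub>R y) \<longlongrightarrow> x) (at_right 0)"
proof -
  have "((\<lambda>t. (1 - t) *\<^sub>R x + t *\<^sub>R y) \<longlongrightarrow> (1 - 0) *\<^sub>R x + 0 *\<^sub>R y) (at_right 0)"
    by (intro tendsto_intros)
  then show ?thesis by simp
qed

lemma eventually_at_right_0_less_1: "eventually (\<lambda>t::real. 0 < t \<and> t < 1) (at_right 0)"
  by (auto simp: eventually_at_right_field intro!: exI[of _ 1])

text \<open>An infinite value at \<open>x\<close> puts points of arbitrary height over
  \<open>x\<close> into the hypograph. Chords from \<open>y\<close> to them lift \<open>f\<close>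
  above \<open>f y + 1\<close> arbitrarily close to \<open>y\<close>, against upper semicontinuity
  at \<open>y\<close>.\<close>

lemma concave_fun_usc_finite:
  fixes f :: "'a::real_normed_vector \<Rightarrow> ennreal"
  assumes "concave_fun f" "usc f" "pos_dom f \<noteq> {}"
  shows "f x < \<infinity>"
proof (rule ccontr)
  assume "\<not> f x < \<infinity>"
  then have fx: "f x = top" by (metis infinity_ennreal_def less_top)
  obtain y where y: "0 < f y" "f y < \<infinity>" using assms(3) unfolding pos_dom_def by blast
  define c where "c = enn2real (f y)"
  have fy: "f y = ennreal c" and c: "0 < c"
    using y by (auto simp: c_def enn2real_positive_iff less_top)
  have "f y < ennreal (c + 1)" using fy c by (simp add: ennreal_less_iff)
  with assms(2) have "eventually (\<lambda>z. f z < ennreal (c + 1)) (nhds y)" by (simp add: usc_def)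
  then have "eventually (\<lambda>t. f ((1 - t) *\<^sub>R y + t *\<^sub>R x) < ennreal (c + 1)) (at_right 0)"
    by (rule eventually_compose_filterlim[OF _ tendsto_segment])
  with eventually_at_right_0_less_1
  have "eventually (\<lambda>t::real. (0 < t \<and> t < 1)
      \<and> f ((1 - t) *\<^sub>R y + t *\<^sub>R x) < ennreal (c + 1)) (at_right 0)"
    by (rule eventually_conj)
  then obtain t :: real where t: "0 < t" "t < 1" "f ((1 - t) *\<^sub>R y + t *\<^sub>R x) < ennreal (c + 1)"
    using eventually_happens trivial_limit_at_right_real by blast
  \<comment> \<open>The height \<open>(1 + t * c) / t\<close> over \<open>x\<close> is chosen so
    that the chord has height exactly \<open>c + 1\<close> at parameter \<open>t\<close>.\<close>
  have "ennreal ((1 - t) * c + t * ((1 + t * c) / t)) \<le> f ((1 - t) *\<^sub>R y + t *\<^sub>R x)"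
    using t c by (intro concave_funD[OF assms(1)]) (auto simp: fx fy intro!: divide_pos_pos add_pos_pos)
  moreover have "(1 - t) * c + t * ((1 + t * c) / t) = c + 1" using t by (simp add: field_simps)
  ultimately show False using t(3) by simp
qed

text \<open>Both directions approach \<open>x\<close> along the segment from \<open>s\<close>, whose
  points before \<open>x\<close> lie in the interior. Closedness of \<open>S\<close> carries
  membership to the limit, and lower semicontinuity carries the bound on
  \<open>\<phi>\<close>.\<close>

lemma convex_identifier_le_1_iff:
  fixes S :: "'a::euclidean_space set"
  assumes "convex_identifier \<phi> S" "closed S" "convex S" "s \<in> interior S"
  shows "\<phi> x \<le> 1 \<longleftrightarrow> x \<in> S"
proof
  have ls: "lsc \<phi>" and cv: "convex_on UNIV \<phi>" and int: "\<And>x. x \<in> interior S \<longleftrightarrow> \<phi> x < 1"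
    using assms(1) by (auto simp: convex_identifier_def)
  {
    assume x: "\<phi> x \<le> 1"
    have "(1 - t) *\<^sub>R x + t *\<^sub>R s \<in> S" if t: "0 < t" "t < 1" for t
    proof -
      have "\<phi> ((1 - t) *\<^sub>R x + t *\<^sub>R s) \<le> (1 - t) * \<phi> x + t * \<phi> s"
        using t by (intro convex_onD[OF cv]) auto
      also have "\<dots> < (1 - t) * 1 + t * 1"
        using t x assms(4) by (intro add_le_less_mono mult_left_mono mult_strict_left_mono)
          (auto simp: int)
      finally show ?thesis using int interior_subset by fastforce
    qed
    then have "eventually (\<lambda>t. (1 - t) *\<^sub>R x + t *\<^sub>R s \<in> S) (at_right 0)"
      by (intro eventually_mono[OF eventually_at_right_0_less_1]) auto
    then show "x \<in> S"
      using Lim_in_closed_set[OF assms(2) _ _ tendsto_segment] by (simp add: trivial_limit_at_right_real)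
  }
  assume x: "x \<in> S"
  have less: "\<phi> ((1 - t) *\<^sub>R x + t *\<^sub>R s) < 1" if t: "0 < t" "t < 1" for t
  proof -
    have "x - t *\<^sub>R (x - s) \<in> interior S"
      using t x assms by (intro mem_interior_convex_shrink) auto
    then show ?thesis by (simp add: int algebra_simps)
  qed
  show "\<phi> x \<le> 1"
  proof (rule ccontr)
    assume "\<not> \<phi> x \<le> 1"
    then have "eventually (\<lambda>z. 1 < \<phi> z) (nhds x)" using ls by (simp add: lsc_def)
    then have "eventually (\<lambda>t. 1 < \<phi> ((1 - t) *\<^sub>R x + t *\<^sub>R s)) (at_right 0)"
      by (rule eventually_compose_filterlim[OF _ tendsto_segment])
    with eventually_at_right_0_less_1
    have "eventually (\<lambda>t::real. False) (at_right 0)"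
      by eventually_elim (use less in force)
    then show False by (simp add: trivial_limit_at_right_real)
  qed
qed

section \<open>The radial transform of a concave function\<close>

locale radial_concave =
  fixes f :: "'a::euclidean_space \<Rightarrow> ennreal" and e :: 'a
  assumes concave: "concave_fun f" and usc: "usc f"
    and center: "e \<in> interior (closure (pos_dom f))"
begin

text \<open>\<open>enn2real\<close> loses nothing here, since \<open>f\<close> is finite everywhere;
  see \<open>f_eq\<close>.\<close>

definition F :: "'a \<Rightarrow> real" where "F x = enn2real (f x)"

lemma f_eq: "f x = ennreal (F x)"
proof -
  have "pos_dom f \<noteq> {}" using center by auto
  from concave_fun_usc_finite[OF concave usc this] show ?thesis
    by (simp add: F_def less_top)
qed

lemma F_nonneg: "0 \<le> F x"
  by (simp add: F_def)

lemma mem_pos_dom_iff: "x \<in> pos_dom f \<longleftrightarrow> 0 < F x"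
  by (simp add: pos_dom_def f_eq)

text \<open>The hypograph records only positive heights, so the inequality is restricted to points
  where \<open>F\<close> is positive; it can fail when one endpoint leaves the domain.\<close>

lemma F_concave:
  assumes "0 < F x" "0 < F y" "0 \<le> t" "t \<le> 1"
  shows "(1 - t) * F x + t * F y \<le> F ((1 - t) *\<^sub>R x + t *\<^sub>R y)"
  using concave_funD[OF concave, of "F x" x "F y" y t] assms
  by (simp add: f_eq F_nonneg del: ennreal_plus)

lemma convex_pos_dom: "convex (pos_dom f)"
  unfolding convex_alt
proof (intro ballI allI impI)
  fix x y :: 'a and t :: real
  assume *: "x \<in> pos_dom f" "y \<in> pos_dom f" "0 \<le> t \<and> t \<le> 1"
  then have "0 < F x" "0 < F y" by (auto simp: mem_pos_dom_iff)
  moreover from this * have "0 < (1 - t) * F x + t * F y"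
    by (cases "t = 0") (auto intro!: add_nonneg_pos)
  ultimately show "(1 - t) *\<^sub>R x + t *\<^sub>R y \<in> pos_dom f"
    using F_concave[of x y t] * by (simp add: mem_pos_dom_iff)
qed

lemma center_interior: "e \<in> interior (pos_dom f)"
  using center convex_interior_closure[OF convex_pos_dom] by simp

lemma F_center_pos: "0 < F e"
  using center_interior interior_subset mem_pos_dom_iff by blast

text \<open>The point \<open>e + (y - e) /\<^sub>R w\<close> divides the segment from
  \<open>e\<close> to \<open>e + (y - e) /\<^sub>R v\<close> with weight \<open>v / w\<close>;
  concavity there, multiplied by \<open>w\<close>, gives the bound.\<close>

lemma perspective_mono:
  assumes "0 < v" "v \<le> w" "1 \<le> v * F (e + (y - e) /\<^sub>R v)"
  shows "1 + (w - v) * F e \<le> w * F (e + (y - e) /\<^sub>R w)"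
proof -
  define a where "a = e + (y - e) /\<^sub>R v"
  have a: "0 < F a" using assms(1,3) F_nonneg[of a] by (cases "F a = 0") (auto simp: a_def)
  have "(1 - v / w) * F e + v / w * F a \<le> F ((1 - v / w) *\<^sub>R e + (v / w) *\<^sub>R a)"
    using assms a F_center_pos by (intro F_concave) auto
  also have "(1 - v / w) *\<^sub>R e + (v / w) *\<^sub>R a = e + (y - e) /\<^sub>R w"
  proof -
    have "(v / w) *\<^sub>R a = (v / w) *\<^sub>R e + (y - e) /\<^sub>R w"
      using assms by (simp add: a_def scaleR_right_distrib divide_inverse)
    then show ?thesis by (simp add: scaleR_left_diff_distrib)
  qed
  finally have "w * ((1 - v / w) * F e + v / w * F a) \<le> w * F (e + (y - e) /\<^sub>R w)"
    using assms by (intro mult_left_mono) auto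
  moreover have "w * ((1 - v / w) * F e + v / w * F a) = (w - v) * F e + v * F a"
    using assms by (simp add: field_simps)
  ultimately show ?thesis using assms(3) by (simp add: a_def)
qed

text \<open>By \<open>perspective_mono\<close> and \<open>F e > 0\<close> the product exceeds 1 at
  every scale above \<open>v\<close>, so no such scale enters the supremum.\<close>

lemma radial_transform_leI:
  assumes "0 < v" "1 \<le> v * F (e + (y - e) /\<^sub>R v)"
  shows "radial_transform e f y \<le> ennreal v"
  unfolding radial_transform_def
proof (rule Sup_least, clarify)
  fix w :: real
  assume w: "0 < w" "ennreal w * f (e + (y - e) /\<^sub>R w) \<le> 1"
  then have "w * F (e + (y - e) /\<^sub>R w) \<le> 1"
    by (simp add: f_eq F_nonneg flip: ennreal_mult)
  moreover have "1 + (w - v) * F e \<le> w * F (e + (y - e) /\<^sub>R w)" if "v < w"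
    using perspective_mono[OF assms(1) _ assms(2)] that by simp
  ultimately show "ennreal w \<le> ennreal v"
    using F_center_pos by (intro ennreal_leI) (smt (verit) mult_pos_pos)
qed

lemma radial_transform_lessD:
  assumes "radial_transform e f y < ennreal v"
  shows "0 < v" "1 < v * F (e + (y - e) /\<^sub>R v)"
proof -
  \<comment> \<open>For \<open>v \<le> 0\<close> the coercion gives \<open>ennreal v = 0\<close>,
    and nothing lies strictly below 0.\<close>
  show v: "0 < v" using assms by (metis ennreal_eq_0_iff not_less not_less_zero)
  show "1 < v * F (e + (y - e) /\<^sub>R v)"
  proof (rule ccontr)
    assume "\<not> 1 < v * F (e + (y - e) /\<^sub>R v)"
    then have "ennreal v * f (e + (y - e) /\<^sub>R v) \<le> 1"
      using v by (simp add: f_eq F_nonneg flip: ennreal_mult)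
    then have "ennreal v \<le> radial_transform e f y"
      unfolding radial_transform_def using v by (intro Sup_upper) auto
    then show False using assms by simp
  qed
qed

lemma radial_transform_le_1_iff: "radial_transform e f y \<le> 1 \<longleftrightarrow> 1 \<le> F y"
proof
  assume "1 \<le> F y"
  then show "radial_transform e f y \<le> 1"
    using radial_transform_leI[of 1 y] by simp
next
  assume le: "radial_transform e f y \<le> 1"
  show "1 \<le> F y"
  proof (rule ccontr)
    assume "\<not> 1 \<le> F y"
    \<comment> \<open>Upper semicontinuity keeps \<open>f\<close> below \<open>c\<close> at the
      rescaled points for \<open>v\<close> slightly above 1. There \<open>v * c < 1\<close>, whereas
      a transform below \<open>v\<close> forces the product above 1.\<close>
    then obtain c where c: "F y < c" "c < 1" using dense[of "F y" 1] by auto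
    then have "f y < ennreal c" by (simp add: f_eq F_nonneg ennreal_less_iff)
    then have ev: "eventually (\<lambda>z. f z < ennreal c) (nhds y)" using usc by (simp add: usc_def)
    have "((\<lambda>v. e + (y - e) /\<^sub>R v) \<longlongrightarrow> e + (y - e) /\<^sub>R 1) (at_right 1)"
      by (intro tendsto_intros) auto
    then have "filterlim (\<lambda>v. e + (y - e) /\<^sub>R v) (nhds y) (at_right 1)" by simp
    with ev have "eventually (\<lambda>v. f (e + (y - e) /\<^sub>R v) < ennreal c) (at_right 1)"
      by (rule eventually_compose_filterlim)
    moreover have "((\<lambda>v. v * c) \<longlongrightarrow> 1 * c) (at_right 1)"
      by (intro tendsto_intros)
    then have "eventually (\<lambda>v. v * c < 1) (at_right 1)"
      using c by (intro order_tendstoD(2)) auto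
    ultimately have "eventually (\<lambda>v::real. False) (at_right 1)"
      using eventually_at_right_less[of "1::real"]
    proof eventually_elim
      case (elim v)
      have "radial_transform e f y < ennreal v"
        using le elim(3) by (simp add: le_less_trans one_less_ennreal)
      from radial_transform_lessD(2)[OF this]
      have "1 < v * F (e + (y - e) /\<^sub>R v)" .
      also have "\<dots> \<le> v * c"
        using elim by (intro mult_left_mono) (auto simp: f_eq F_nonneg ennreal_less_iff)
      finally show False using elim by simp
    qed
    then show False by (simp add: trivial_limit_at_right_real)
  qed
qed

lemma radial_transform_less_1D:
  assumes "radial_transform e f y < 1"
  shows "1 < F y"
proof -
  obtain c where c: "radial_transform e f y < c" "c < 1" using assms dense by blast
  then obtain v where v: "c = ennreal v" "0 \<le> v" by (cases c) auto
  have "0 < v" "1 < v * F (e + (y - e) /\<^sub>R v)"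
    using c radial_transform_lessD[of y v] v by auto
  moreover have "v < 1" using c v by simp
  \<comment> \<open>At scale 1 the rescaled point is \<open>y\<close> itself, and the surplus
    \<open>(1 - v) * F e\<close> makes the inequality strict.\<close>
  ultimately have "1 + (1 - v) * F e \<le> 1 * F (e + (y - e) /\<^sub>R 1)"
    by (intro perspective_mono) auto
  with \<open>v < 1\<close> F_center_pos show ?thesis by (simp add: add_pos_pos less_le_trans[rotated])
qed

text \<open>An interior point leaves room on the ray from \<open>e\<close> beyond \<open>x\<close>,
  where a scale below 1 can be found. At a boundary point of the domain, \<open>f\<close> vanishes
  just beyond \<open>x\<close> and the transform is at least 1.\<close>

lemma radial_transform_less_1I:
  assumes "x \<in> interior (pos_dom f)" "1 < F x"
  shows "radial_transform e f x < 1"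
proof -
  have "((\<lambda>v. e + (x - e) /\<^sub>R v) \<longlongrightarrow> e + (x - e) /\<^sub>R 1) (at_left 1)"
    by (intro tendsto_intros) auto
  then have "filterlim (\<lambda>v. e + (x - e) /\<^sub>R v) (nhds x) (at_left 1)" by simp
  then have "eventually (\<lambda>v. e + (x - e) /\<^sub>R v \<in> interior (pos_dom f)) (at_left 1)"
    by (rule topological_tendstoD) (use assms in auto)
  moreover have "eventually (\<lambda>v::real. 0 < v \<and> v < 1) (at_left 1)"
    by (auto simp: eventually_at_left_field intro!: exI[of _ 0])
  ultimately have "eventually (\<lambda>v::real. (e + (x - e) /\<^sub>R v \<in> interior (pos_dom f))
      \<and> 0 < v \<and> v < 1) (at_left 1)"
    by (rule eventually_conj)
  then obtain v :: real
    where v: "e + (x - e) /\<^sub>R v \<in> interior (pos_dom f)" "0 < v" "v < 1"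
    using eventually_happens trivial_limit_at_left_real by blast
  \<comment> \<open>Here \<open>b - e = (1 + k) *\<^sub>R (x - e)\<close>, so moving from
    \<open>x\<close> towards \<open>b\<close> with weight \<open>r\<close> rescales
    \<open>x - e\<close> by \<open>1 + r * k\<close>.\<close>
  define b k where "b = e + (x - e) /\<^sub>R v" and "k = 1 / v - 1"
  have b: "0 < F b" using v interior_subset mem_pos_dom_iff by (auto simp: b_def)
  have k: "0 < k" using v by (simp add: k_def)
  \<comment> \<open>The value of \<open>r\<close> solves \<open>(1 - r) * F x = 1 + r * k\<close>.\<close>
  define r where "r = (F x - 1) / (F x + k)"
  have r: "0 < r" "r < 1" using assms(2) k by (auto simp: r_def)
  have req: "(1 - r) * F x = 1 + r * k" using assms(2) k by (simp add: r_def field_simps)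
  have rk: "0 < 1 + r * k" using r k by (simp add: add_pos_pos)
  have "(1 - r) * F x \<le> (1 - r) * F x + r * F b" using r b by simp
  also have "\<dots> \<le> F ((1 - r) *\<^sub>R x + r *\<^sub>R b)" using r b assms by (intro F_concave) auto
  also have "(1 - r) *\<^sub>R x + r *\<^sub>R b = e + (x - e) /\<^sub>R (1 / (1 + r * k))"
    using v by (simp add: b_def k_def algebra_simps divide_inverse)
  finally have "1 \<le> 1 / (1 + r * k) * F (e + (x - e) /\<^sub>R (1 / (1 + r * k)))"
    unfolding req using rk by (simp add: field_simps)
  then have "radial_transform e f x \<le> ennreal (1 / (1 + r * k))"
    using rk by (intro radial_transform_leI) auto
  also have "\<dots> < 1" using r k by (simp add: rk)
  finally show ?thesis .
qed

text \<open>A gauge below 1 makes \<open>x\<close> a convex combination of a closure point and the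
  interior point \<open>e\<close>, the latter with positive weight \<open>1 - v\<close>.\<close>

lemma mem_interior_pos_dom_if_gauge_less_1:
  assumes "gauge_at (closure (pos_dom f)) e x < 1"
  shows "x \<in> interior (pos_dom f)"
proof -
  obtain v where v: "0 < v" "v < 1" "e + (x - e) /\<^sub>R v \<in> closure (pos_dom f)"
    using assms by (auto simp: gauge_at_def Inf_less_iff)
  define a where "a = e + (x - e) /\<^sub>R v"
  have "a - (1 - v) *\<^sub>R (a - e) \<in> interior (pos_dom f)"
    using v center_interior convex_pos_dom
    by (intro mem_interior_closure_convex_shrink) (auto simp: a_def)
  also have "a - (1 - v) *\<^sub>R (a - e) = x"
    using v by (simp add: a_def algebra_simps)
  finally show ?thesis .
qed

end

section \<open>Comparison of the primal and dual objectives, with Slater point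
  \<open>s\<close>\<close>

locale radial_program = radial_concave f e
  for f :: "'a::euclidean_space \<Rightarrow> ennreal" and e :: 'a +
  fixes \<phi> :: "'a \<Rightarrow> real" and S :: "'a set" and s :: 'a
  assumes closed: "closed S" and convex: "convex S" and phi_identifier: "convex_identifier \<phi> S"
    and slater: "s \<in> interior S" "s \<in> pos_dom f"
begin

lemma phi_le_1_iff: "\<phi> x \<le> 1 \<longleftrightarrow> x \<in> S"
  by (rule convex_identifier_le_1_iff[OF phi_identifier closed convex slater(1)])

lemma phi_convex: "convex_on UNIV \<phi>"
  using phi_identifier by (simp add: convex_identifier_def)

lemma phi_slater: "\<phi> s < 1"
  using phi_identifier slater(1) by (auto simp: convex_identifier_def)

lemma F_slater: "0 < F s"
  using slater(2) mem_pos_dom_iff by simp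

lemma primal_fun_eq: "primal_fun f S x = (if x \<in> S then ereal (F x) else 0)"
  by (simp add: primal_fun_def upper_indicator_def f_eq F_nonneg)

lemma dual_fun_le_1_iff: "dual_fun e f \<phi> y \<le> 1 \<longleftrightarrow> y \<in> S \<and> 1 \<le> F y"
  using phi_le_1_iff radial_transform_le_1_iff[of y]
  by (auto simp: dual_fun_def less_eq_ennreal.rep_eq one_ennreal.rep_eq)

lemma dual_fun_less_1D: "dual_fun e f \<phi> y < 1 \<Longrightarrow> y \<in> S \<and> 1 < F y"
  using phi_le_1_iff[of y] radial_transform_less_1D[of y]
  by (auto simp: dual_fun_def less_ennreal.rep_eq one_ennreal.rep_eq)

text \<open>This excludes \<open>pstar > 1\<close> when \<open>dstar = 1\<close>. A small move
  towards \<open>s\<close> makes \<open>\<phi>\<close> strictly less than 1 even if \<open>x\<close>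
  is on the boundary of \<open>S\<close>, while the gauge condition keeps the new point interior to
  the domain.\<close>

lemma exists_dual_fun_less_1:
  assumes "x \<in> S" "1 < F x" "gauge_at (closure (pos_dom f)) e x < 1"
  shows "\<exists>y. dual_fun e f \<phi> y < 1"
proof -
  \<comment> \<open>With this weight \<open>(1 - t) * F x\<close> is the midpoint of 1 and
    \<open>F x\<close>, hence still above 1.\<close>
  define t where "t = (F x - 1) / (2 * F x)"
  have t: "0 < t" "t < 1" using assms(2) by (auto simp: t_def field_simps)
  define y where "y = (1 - t) *\<^sub>R x + t *\<^sub>R s"
  have "s - (1 - t) *\<^sub>R (s - x) \<in> interior (pos_dom f)"
    using t slater(2) convex_pos_dom closure_subset
    by (intro mem_interior_closure_convex_shrink mem_interior_pos_dom_if_gauge_less_1 assms) auto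
  also have "s - (1 - t) *\<^sub>R (s - x) = y" by (simp add: y_def algebra_simps)
  finally have int: "y \<in> interior (pos_dom f)" .
  have "(1 - t) * F x = (F x + 1) / 2" using assms(2) by (simp add: t_def field_simps)
  then have "1 < (1 - t) * F x" using assms(2) by simp
  also have "\<dots> \<le> (1 - t) * F x + t * F s" using t F_slater by simp
  also have "\<dots> \<le> F y" unfolding y_def using t assms(2) F_slater by (intro F_concave) auto
  finally have "radial_transform e f y < 1" by (rule radial_transform_less_1I[OF int])
  moreover have "\<phi> y \<le> (1 - t) * \<phi> x + t * \<phi> s"
    unfolding y_def using t by (intro convex_onD[OF phi_convex]) auto
  moreover have "(1 - t) * \<phi> x + t * \<phi> s < (1 - t) * 1 + t * 1"
    using t phi_slater assms(1) phi_le_1_iff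
    by (intro add_le_less_mono mult_left_mono mult_strict_left_mono) auto
  ultimately show ?thesis
    by (auto simp: dual_fun_def less_ennreal.rep_eq one_ennreal.rep_eq)
qed

text \<open>Two moves repair \<open>y\<close>. Contracting it towards \<open>e\<close> by the factor
  \<open>1 + \<epsilon>\<close> gives \<open>F w > 1 / (1 + \<epsilon>)\<close> and
  \<open>\<phi> w \<le> 1 + \<bar>\<phi> e\<bar> * \<epsilon>\<close>, as \<open>e\<close> may be
  infeasible. Mixing with \<open>s\<close> then restores \<open>\<phi> z \<le> 1\<close> at a
  controlled loss of \<open>F\<close>.\<close>

lemma exists_feasible_if_dual_fun_less:
  assumes "0 < \<epsilon>" "dual_fun e f \<phi> y < ereal (1 + \<epsilon>)"
  shows "\<exists>z\<in>S. (1 - \<phi> s) / ((1 - \<phi> s + \<bar>\<phi> e\<bar> * \<epsilon>) * (1 + \<epsilon>)) \<le> F z"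
proof -
  define K \<delta> w where "K = \<bar>\<phi> e\<bar>" and "\<delta> = 1 - \<phi> s" and "w = e + (y - e) /\<^sub>R (1 + \<epsilon>)"
  have \<delta>: "0 < \<delta>" and K: "0 \<le> K" using phi_slater by (auto simp: \<delta>_def K_def)
  have "radial_transform e f y < ennreal (1 + \<epsilon>)" and y: "\<phi> y < 1 + \<epsilon>"
    using assms by (auto simp: dual_fun_def less_ennreal.rep_eq enn2ereal_ennreal simp del: ennreal_plus)
  from this(1) have "1 < (1 + \<epsilon>) * F w"
    unfolding w_def by (rule radial_transform_lessD)
  then have Fw: "1 / (1 + \<epsilon>) < F w" using assms(1) by (simp add: field_simps)
  then have Fw_pos: "0 < F w" using assms(1) by (smt (verit) divide_pos_pos)
  define q where "q = 1 / (1 + \<epsilon>)"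
  have q: "0 < q" "q \<le> 1" "q * (1 + \<epsilon>) = 1" "1 - q \<le> \<epsilon>"
    using assms(1) by (auto simp: q_def field_simps)
  have w_eq: "w = (1 - q) *\<^sub>R e + q *\<^sub>R y"
    by (simp add: w_def q_def algebra_simps divide_inverse)
  have "\<phi> w \<le> (1 - q) * \<phi> e + q * \<phi> y"
    unfolding w_eq using q by (intro convex_onD[OF phi_convex]) auto
  also have "\<dots> \<le> (1 - q) * K + q * (1 + \<epsilon>)"
    using q y by (intro add_mono mult_left_mono) (auto simp: K_def)
  also have "\<dots> \<le> \<epsilon> * K + 1"
    using q K by (intro add_mono mult_right_mono) auto
  finally have \<phi>w: "\<phi> w \<le> 1 + K * \<epsilon>" by (simp add: mult.commute)
  have pos: "0 < \<delta> + K * \<epsilon>" using \<delta> K assms(1) by (simp add: add_pos_nonneg)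
  \<comment> \<open>This weight solves
    \<open>(1 - t) * (\<delta> + K * \<epsilon>) = \<delta>\<close>, which makes the convexity bound
    on \<open>\<phi> z\<close> exactly 1.\<close>
  define t where "t = K * \<epsilon> / (\<delta> + K * \<epsilon>)"
  have t: "0 \<le> t" "t \<le> 1" "1 - t = \<delta> / (\<delta> + K * \<epsilon>)"
    using pos \<delta> K assms(1) by (auto simp: t_def field_simps)
  define z where "z = (1 - t) *\<^sub>R w + t *\<^sub>R s"
  have "\<phi> z \<le> (1 - t) * \<phi> w + t * \<phi> s"
    unfolding z_def using t by (intro convex_onD[OF phi_convex]) auto
  also have "\<dots> \<le> (1 - t) * (1 + K * \<epsilon>) + t * \<phi> s"
    using t \<phi>w by (intro add_mono mult_left_mono) auto
  also have "\<dots> = (1 - t) * (\<delta> + K * \<epsilon>) + \<phi> s" by (simp add: \<delta>_def algebra_simps)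
  also have "\<dots> = 1" using pos by (simp add: t(3)) (simp add: \<delta>_def)
  finally have "z \<in> S" by (simp add: phi_le_1_iff)
  have "\<delta> / ((\<delta> + K * \<epsilon>) * (1 + \<epsilon>)) = (1 - t) * (1 / (1 + \<epsilon>))" by (simp add: t(3))
  also have "\<dots> \<le> (1 - t) * F w" using t Fw by (intro mult_left_mono) auto
  also have "\<dots> \<le> (1 - t) * F w + t * F s" using t F_slater by simp
  also have "\<dots> \<le> F z" unfolding z_def using t Fw_pos F_slater by (intro F_concave) auto
  finally show ?thesis using \<open>z \<in> S\<close> by (auto simp: \<delta>_def K_def)
qed

text \<open>This excludes \<open>pstar < 1\<close> when \<open>dstar = 1\<close>: the lower bound
  obtained from points with dual value below \<open>1 + \<epsilon>\<close> tends to 1 as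
  \<open>\<epsilon>\<close> decreases to 0.\<close>

lemma one_le_if_INF_dual_fun_le_1:
  assumes "(INF y. dual_fun e f \<phi> y) \<le> 1" "\<And>z. z \<in> S \<Longrightarrow> F z \<le> p"
  shows "1 \<le> p"
proof (rule tendsto_upperbound)
  define \<delta> where "\<delta> = 1 - \<phi> s"
  have \<delta>: "0 < \<delta>" using phi_slater by (simp add: \<delta>_def)
  let ?h = "\<lambda>\<epsilon>. \<delta> / ((\<delta> + \<bar>\<phi> e\<bar> * \<epsilon>) * (1 + \<epsilon>))"
  have "(?h \<longlongrightarrow> \<delta> / ((\<delta> + \<bar>\<phi> e\<bar> * 0) * (1 + 0))) (at_right 0)"
    using \<delta> by (intro tendsto_intros) auto
  then show "(?h \<longlongrightarrow> 1) (at_right 0)" using \<delta> by simp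
  show "eventually (\<lambda>\<epsilon>. ?h \<epsilon> \<le> p) (at_right 0)"
    using eventually_at_right_less[of "0::real"]
  proof eventually_elim
    case (elim \<epsilon>)
    have "(INF y. dual_fun e f \<phi> y) < ereal (1 + \<epsilon>)"
      using elim by (intro le_less_trans[OF assms(1)]) (simp add: one_ereal_def)
    then obtain y where "dual_fun e f \<phi> y < ereal (1 + \<epsilon>)" by (auto simp: INF_less_iff)
    from exists_feasible_if_dual_fun_less[OF elim this] obtain z
      where "z \<in> S" "?h \<epsilon> \<le> F z" by (auto simp: \<delta>_def)
    with assms(2) show ?case by force
  qed
qed (simp add: trivial_limit_at_right_real)

text \<open>Once both optimal values are 1 and attained at \<open>x\<close>, the maximizers are the
  points with primal value at least 1 and the minimizers those with dual value at most 1;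
  \<open>dual_fun_le_1_iff\<close> identifies the two level sets.\<close>

lemma radial_duality_value_1:
  assumes "x \<in> S" "F x = 1" "\<And>z. z \<in> S \<Longrightarrow> F z \<le> 1"
  shows "(INF y. dual_fun e f \<phi> y) = 1"
    and "argmax (primal_fun f S) = argmin (dual_fun e f \<phi>)"
proof -
  have ge: "1 \<le> dual_fun e f \<phi> y" for y
    using dual_fun_less_1D[of y] assms(3)[of y] by (meson not_le)
  have x: "dual_fun e f \<phi> x = 1"
    using ge[of x] dual_fun_le_1_iff[of x] assms by (simp add: order_antisym)
  show "(INF y. dual_fun e f \<phi> y) = 1"
    using ge x by (metis INF_greatest INF_lower UNIV_I order_antisym)
  have le: "primal_fun f S z \<le> 1" for z
    using assms(3)[of z] by (auto simp: primal_fun_eq one_ereal_def)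
  have "primal_fun f S x = 1" using assms by (simp add: primal_fun_eq)
  then have "z \<in> argmax (primal_fun f S) \<longleftrightarrow> 1 \<le> primal_fun f S z" for z
    using le by (auto simp: argmax_def is_arg_max_def) (metis not_le, metis leD order_le_less_trans)
  moreover have "1 \<le> primal_fun f S z \<longleftrightarrow> z \<in> S \<and> 1 \<le> F z" for z
    by (auto simp: primal_fun_eq)
  moreover have "z \<in> argmin (dual_fun e f \<phi>) \<longleftrightarrow> dual_fun e f \<phi> z \<le> 1" for z
    using ge x by (auto simp: argmin_def is_arg_min_def) (metis not_le, metis leD order_less_le_trans)
  ultimately show "argmax (primal_fun f S) = argmin (dual_fun e f \<phi>)"
    using dual_fun_le_1_iff by blast
qed

end

theorem theorem3p1:
  fixes f :: "'a::euclidean_space \<Rightarrow> ennreal"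
    and S :: "nat \<Rightarrow> 'a set" and m :: nat
    and SS S0 :: "'a set"
    and \<phi> :: "'a \<Rightarrow> real"
    and e0 xstar xSL :: 'a
    and pstar dstar \<eta> :: ereal
    and \<Psi> \<Phi> :: "'a \<Rightarrow> ereal"
  assumes "concave_fun f" and "usc f"
    and "S0 = closure (pos_dom f)" and "diam S0 < \<infinity>"
    and "1 \<le> m"
    and "\<And>j. j \<in> {1..m} \<Longrightarrow> closed (S j)"
    and "\<And>j. j \<in> {1..m} \<Longrightarrow> convex (S j)"
    and "SS = (\<Inter>j\<in>{1..m}. S j)"
    and "convex_identifier \<phi> SS"
    and "e0 \<in> interior S0" and "0 < radius_at e0 S0"
    and "\<Psi> = primal_fun f SS"
    and "\<Phi> = dual_fun e0 f \<phi>"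
    and "pstar = (SUP x. \<Psi> x)"
    and "dstar = (INF y. \<Phi> y)"
    and "xstar \<in> SS" and "enn2ereal (f xstar) = pstar" and "0 < pstar"
    and "xSL \<in> interior SS \<inter> pos_dom f"
    and "\<eta> = (1 - gauge_at S0 e0 xstar) * (1 - ereal (\<phi> xSL))" and "0 < \<eta>"
    and "pstar = 1 \<or> dstar = 1"
  shows "argmax \<Psi> \<times> {pstar} = argmin \<Phi> \<times> {dstar}"
proof -
  have "closed SS" "convex SS"
    using assms(6-8) by (auto intro!: closed_INT convex_INT)
  then interpret radial_program f e0 \<phi> SS xSL
    using assms(1-3,9,10,19) by unfold_locales auto
  have pstar: "pstar = ereal (F xstar)"
    using assms(17) by (simp add: f_eq F_nonneg flip: assms(17))
  have max: "F z \<le> F xstar" if "z \<in> SS" for z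
  proof -
    have "\<Psi> z \<le> pstar" unfolding assms(14) by (rule SUP_upper) simp
    then show ?thesis using that by (simp add: assms(12) primal_fun_eq pstar)
  qed
  \<comment> \<open>The Slater factor of \<open>\<eta>\<close> is positive, so positivity of the
    product passes to the gauge factor.\<close>
  have "gauge_at S0 e0 xstar < 1"
  proof (rule ccontr)
    assume "\<not> gauge_at S0 e0 xstar < 1"
    then have "1 - gauge_at S0 e0 xstar \<le> 0"
      by (cases "gauge_at S0 e0 xstar") (auto simp: one_ereal_def)
    moreover have "0 < 1 - ereal (\<phi> xSL)" using phi_slater by (simp add: one_ereal_def)
    ultimately show False
      using assms(20,21) by (auto simp: ereal_zero_less_0_iff)
  qed
  then have gauge: "gauge_at (closure (pos_dom f)) e0 xstar < 1" by (simp add: assms(3))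
  \<comment> \<open>Both alternatives reduce to optimal primal value 1; if only
    \<open>dstar = 1\<close> is given, the two exclusion lemmas above bound \<open>F xstar\<close>
    from either side.\<close>
  have "F xstar = 1"
  proof (cases "pstar = 1")
    case True
    then show ?thesis by (simp add: pstar)
  next
    case False
    then have d: "(INF y. dual_fun e0 f \<phi> y) = 1" using assms(13,15,22) by simp
    then have "1 \<le> F xstar" using max by (intro one_le_if_INF_dual_fun_le_1) auto
    moreover have "\<not> 1 < F xstar"
      using exists_dual_fun_less_1[OF assms(16) _ gauge] d
      by (metis INF_lower UNIV_I leD)
    ultimately show ?thesis by simp
  qed
  with max assms(16) have "(INF y. dual_fun e0 f \<phi> y) = 1"
    "argmax (primal_fun f SS) = argmin (dual_fun e0 f \<phi>)"
    using radial_duality_value_1[of xstar] by auto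
  then show ?thesis
    using \<open>F xstar = 1\<close> by (simp add: assms(12,13,15) pstar one_ereal_def)
qed

end
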